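(* Let $A$ be a (possibly unbounded) scalar type spectral operator in a complex Banach space $(X,\|\cdot\|)$ with spectral measure $E_A(\cdot)$. (1) If $F:\sigma(A)\to\mathbb{C}$ is a Borel measurable function, then for every Borel subset $\sigma\subseteq\sigma(A)$ with $E_A(\sigma)=0$, $$\sigma(F(A))\subseteq\overline{F(\sigma(A)\setminus\sigma)}.$$ (2) If $F:\sigma(A)\to\mathbb{C}$ is a Borel measurable function and $\sigma$ is a Borel subset of $\sigma(A)$ such that $E_A(\sigma)=0$ and $F$ is continuous on $\sigma(A)\setminus\sigma$, then $$\sigma(F(A))=\overline{F(\sigma(A)\setminus\sigma)}.$$
   Context: Spectrum: for a closed linear operator $B$ in $X$, the resolvent set $\rho(B)$ is the set of $\lambda\in\mathbb{C}$ for which $(B-\lambda I)^{-1}$ exists as a bounded linear operator on all of $X$, and $\sigma(B)=\mathbb{C}\setminus\rho(B)$. Scalar type spectral operator (Dunford, Bade): a densely defined closed linear operator $A$ in $X$ for which there is a (necessarily unique) strongly $\sigma$-additive spectral measure $E_A$ (the resolution of the identity), i.e. a map from the Borel sets of $\mathbb{C}$ to bounded projections on $X$ with $E_A(\emptyset)=0$, $E_A(\mathbb{C})=I$, $E_A(\delta_1\cap\delta_2)=E_A(\delta_1)E_A(\delta_2)$, and $\sigma$-additive in the strong operator topology, such that $A=\int_{\mathbb{C}}\lambda\,dE_A(\lambda)$. The spectrum $\sigma(A)$ is the support of $E_A$: $\sigma(A)$ is closed, $E_A(\mathbb{C}\setminus\sigma(A))=0$, and $E_A(U)\ne0$ for every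 open $U\subseteq\mathbb{C}$ meeting $\sigma(A)$. Borel operational calculus: for a bounded Borel function $G$ on $\sigma(A)$, $\int_{\sigma(A)} G\,dE_A$ is the operator-norm limit of the integrals of simple Borel functions converging uniformly to $G$. For a Borel measurable $F:\sigma(A)\to\mathbb{C}$, put $e_n=\{\lambda\in\sigma(A):|F(\lambda)|\le n\}$; then $F(A)=\int_{\sigma(A)}F(\lambda)\,dE_A(\lambda)$ is the operator with domain consisting of all $f\in X$ for which $\lim_{n\to\infty}\left(\int_{\sigma(A)} F\chi_{e_n}\,dE_A\right)f$ exists, $F(A)f$ being this limit. The integral $A=\int\lambda\,dE_A(\lambda)$ is understood in the same way (with $F(\lambda)=\lambda$). $F(A)$ is again a scalar type spectral operator. "$F$ is continuous on $\sigma(A)\setminus\sigma$" means that the restriction of $F$ to $\sigma(A)\setminus\sigma$ (with the subspace topology) is continuous. The bar denotes closure in $\mathbb{C}$. *)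

theory Defs
  imports "HOL-Analysis.Analysis"
begin

class complex_normed_vector = real_normed_vector +
  fixes scaleC :: "complex \<Rightarrow> 'a \<Rightarrow> 'a"  (infixr \<open>*\<^sub>C\<close> 75)
  assumes scaleC_add_right: "c *\<^sub>C (x + y) = c *\<^sub>C x + c *\<^sub>C y"
    and scaleC_add_left: "(c + d) *\<^sub>C x = c *\<^sub>C x + d *\<^sub>C x"
    and scaleC_scaleC: "c *\<^sub>C (d *\<^sub>C x) = (c * d) *\<^sub>C x"
    and scaleC_one: "1 *\<^sub>C x = x"
    and scaleR_scaleC: "r *\<^sub>R x = complex_of_real r *\<^sub>C x"
    and norm_scaleC: "norm (c *\<^sub>C x) = cmod c * norm x"

class complex_banach = complex_normed_vector + complete_space

subclass (in complex_banach) banach ..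

lemma vector_space_scaleC:
  "vector_space (scaleC :: complex \<Rightarrow> 'a::complex_normed_vector \<Rightarrow> 'a)"
  by standard (simp_all add: scaleC_add_right scaleC_add_left scaleC_scaleC scaleC_one)

lemma bounded_linear_scaleC: "bounded_linear (\<lambda>x::'a::complex_normed_vector. c *\<^sub>C x)"
proof
  show "c *\<^sub>C (x + y) = c *\<^sub>C x + c *\<^sub>C y" for x y :: 'a
    by (rule scaleC_add_right)
  show "c *\<^sub>C (r *\<^sub>R x) = r *\<^sub>R (c *\<^sub>C x)" for r and x :: 'a
    by (simp add: scaleR_scaleC scaleC_scaleC mult.commute)
  show "\<exists>K. \<forall>x::'a. norm (c *\<^sub>C x) \<le> norm x * K"
    by (intro exI[of _ "cmod c"]) (simp add: norm_scaleC mult.commute)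
qed

text \<open>
  The type \<open>'a \<Rightarrow>\<^sub>L 'b\<close> consists of the bounded real-linear maps, with the operator norm.
  Complex linearity is imposed separately by \<open>clinear\<close> where it is needed.
\<close>

instantiation blinfun :: (real_normed_vector, complex_normed_vector) complex_normed_vector
begin

lift_definition scaleC_blinfun :: "complex \<Rightarrow> ('a \<Rightarrow>\<^sub>L 'b) \<Rightarrow> ('a \<Rightarrow>\<^sub>L 'b)"
  is "\<lambda>c T x. c *\<^sub>C T x"
  by (rule bounded_linear_compose[OF bounded_linear_scaleC])

instance
proof
  fix c d :: complex and r :: real and S T :: "'a \<Rightarrow>\<^sub>L 'b"
  show "c *\<^sub>C (S + T) = c *\<^sub>C S + c *\<^sub>C T"
    by transfer (simp add: scaleC_add_right)
  show "(c + d) *\<^sub>C T = c *\<^sub>C T + d *\<^sub>C T"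
    by transfer (simp add: scaleC_add_left)
  show "c *\<^sub>C (d *\<^sub>C T) = (c * d) *\<^sub>C T"
    by transfer (simp add: scaleC_scaleC)
  show "1 *\<^sub>C T = T"
    by transfer (simp add: scaleC_one)
  show "r *\<^sub>R T = complex_of_real r *\<^sub>C T"
    by transfer (simp add: scaleR_scaleC)
  have "norm (c *\<^sub>C T) = onorm (\<lambda>x. cmod c *\<^sub>R blinfun_apply T x)"
    by (simp add: norm_blinfun.rep_eq scaleC_blinfun.rep_eq onorm_def norm_scaleC)
  also have "\<dots> = cmod c * norm T"
    by (simp add: onorm_scaleR blinfun.bounded_linear_right norm_blinfun.rep_eq)
  finally show "norm (c *\<^sub>C T) = cmod c * norm T" .
qed

end

definition clinear ::
    "('a::complex_normed_vector \<Rightarrow> 'b::complex_normed_vector) \<Rightarrow> bool"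
  where "clinear T \<longleftrightarrow> Vector_Spaces.linear scaleC scaleC T"

text \<open>
  A not necessarily everywhere defined operator \<open>B\<close> in \<open>'a\<close> is identified with its graph:
  \<open>(f, g) \<in> B\<close> means that \<open>f\<close> lies in the domain of \<open>B\<close> and \<open>B f = g\<close>.  Equality of
  graphs thus includes equality of domains.
\<close>

type_synonym 'a op_graph = "('a \<times> 'a) set"

definition linear_operator :: "'a::complex_normed_vector op_graph \<Rightarrow> bool"
  where "linear_operator B \<longleftrightarrow>
    single_valued B \<and> (0, 0) \<in> B \<and>
    (\<forall>f g f' g'. (f, g) \<in> B \<longrightarrow> (f', g') \<in> B \<longrightarrow> (f + f', g + g') \<in> B) \<and>
    (\<forall>c f g. (f, g) \<in> B \<longrightarrow> (c *\<^sub>C f, c *\<^sub>C g) \<in> B)"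

definition closed_operator :: "'a::complex_normed_vector op_graph \<Rightarrow> bool"
  where "closed_operator B \<longleftrightarrow> linear_operator B \<and> closed B"

definition densely_defined :: "'a::complex_normed_vector op_graph \<Rightarrow> bool"
  where "densely_defined B \<longleftrightarrow> closure (Domain B) = UNIV"

definition minus_scalar :: "'a::complex_normed_vector op_graph \<Rightarrow> complex \<Rightarrow> 'a op_graph"
  where "minus_scalar B l = {(f, g - l *\<^sub>C f) | f g. (f, g) \<in> B}"

definition resolvent_set :: "'a::complex_normed_vector op_graph \<Rightarrow> complex set"
  where "resolvent_set B =
    {l. \<exists>R :: 'a \<Rightarrow>\<^sub>L 'a. clinear (blinfun_apply R) \<and>
          (minus_scalar B l)\<inverse> = {(g, blinfun_apply R g) | g. True}}"

definition spectrum :: "'a::complex_normed_vector op_graph \<Rightarrow> complex set"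
  where "spectrum B = - resolvent_set B"

text \<open>Only the values of \<open>E\<close> at Borel sets are meaningful.\<close>

definition spectral_measure ::
    "(complex set \<Rightarrow> 'a::complex_normed_vector \<Rightarrow>\<^sub>L 'a) \<Rightarrow> bool"
  where "spectral_measure E \<longleftrightarrow>
    (\<forall>D \<in> sets borel. clinear (blinfun_apply (E D)) \<and> E D o\<^sub>L E D = E D) \<and>
    E {} = 0 \<and> E UNIV = id_blinfun \<and>
    (\<forall>D1 \<in> sets borel. \<forall>D2 \<in> sets borel. E (D1 \<inter> D2) = E D1 o\<^sub>L E D2) \<and>
    (\<forall>D :: nat \<Rightarrow> complex set. range D \<subseteq> sets borel \<longrightarrow> disjoint_family D \<longrightarrow>
      (\<forall>f. (\<lambda>n. blinfun_apply (E (D n)) f) sums blinfun_apply (E (\<Union>n. D n)) f))"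

definition simple_integral ::
    "(complex set \<Rightarrow> 'a::complex_normed_vector \<Rightarrow>\<^sub>L 'a) \<Rightarrow> complex set
      \<Rightarrow> (complex \<Rightarrow> complex) \<Rightarrow> 'a \<Rightarrow>\<^sub>L 'a"
  where "simple_integral E S s = (\<Sum>z \<in> s ` S. z *\<^sub>C E (s -` {z} \<inter> S))"

text \<open>
  The integral over \<open>S\<close> of a bounded Borel function \<open>G\<close>; the value is not meaningful if
  \<open>G\<close> is not a uniform limit on \<open>S\<close> of simple Borel functions.  The limit of the integrals
  is taken in operator norm, that is, in the norm of \<open>'a \<Rightarrow>\<^sub>L 'a\<close>.
\<close>

definition bounded_integral ::
    "(complex set \<Rightarrow> 'a::complex_normed_vector \<Rightarrow>\<^sub>L 'a) \<Rightarrow> complex set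
      \<Rightarrow> (complex \<Rightarrow> complex) \<Rightarrow> 'a \<Rightarrow>\<^sub>L 'a"
  where "bounded_integral E S G =
    (THE T. \<forall>s :: nat \<Rightarrow> complex \<Rightarrow> complex.
       (\<forall>n. simple_function (restrict_space borel S) (s n)) \<longrightarrow>
       uniform_limit S s G sequentially \<longrightarrow>
       (\<lambda>n. simple_integral E S (s n)) \<longlonglongrightarrow> T)"

definition spectral_integral ::
    "(complex set \<Rightarrow> 'a::complex_normed_vector \<Rightarrow>\<^sub>L 'a) \<Rightarrow> complex set
      \<Rightarrow> (complex \<Rightarrow> complex) \<Rightarrow> 'a op_graph"
  where "spectral_integral E S F =
    {(f, g). (\<lambda>n::nat. blinfun_apply
        (bounded_integral E S (\<lambda>z. F z * indicator {w \<in> S. cmod (F w) \<le> real n} z)) f)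
      \<longlonglongrightarrow> g}"

definition resolution_of_identity ::
    "'a::complex_normed_vector op_graph \<Rightarrow> (complex set \<Rightarrow> 'a \<Rightarrow>\<^sub>L 'a) \<Rightarrow> bool"
  where "resolution_of_identity A E \<longleftrightarrow>
    spectral_measure E \<and> A = spectral_integral E UNIV (\<lambda>z. z)"

definition scalar_type_spectral :: "'a::complex_normed_vector op_graph \<Rightarrow> bool"
  where "scalar_type_spectral A \<longleftrightarrow>
    closed_operator A \<and> densely_defined A \<and> (\<exists>E. resolution_of_identity A E)"

text \<open>
  \<open>F(A)\<close>, where \<open>E\<close> is the resolution of the identity of \<open>A\<close>; the values of \<open>F\<close> outside
  the spectrum of \<open>A\<close> are irrelevant.
\<close>

definition borel_calculus ::
    "'a::complex_normed_vector op_graph \<Rightarrow> (complex set \<Rightarrow> 'a \<Rightarrow>\<^sub>L 'a)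
      \<Rightarrow> (complex \<Rightarrow> complex) \<Rightarrow> 'a op_graph"
  where "borel_calculus A E F = spectral_integral E (spectrum A) F"

end

theory Submission
  imports Defs
begin

text \<open>
  For \<open>l\<close> outside the closure of \<open>F ` (\<sigma>(A) - N)\<close> the function \<open>1 / (F - l)\<close> is bounded off the
  null set \<open>N\<close>, and its integral inverts \<open>F(A) - l\<close>.  Conversely, if \<open>F\<close> is continuous off \<open>N\<close>
  and \<open>l\<close> is close to \<open>F z\<close>, then \<open>F\<close> is almost constant on a neighbourhood \<open>D\<close> of \<open>z\<close>, up to \<open>N\<close>;
  since \<open>z\<close> lies in the support of \<open>E\<close>, the range of \<open>E D\<close> is nonzero and consists of approximate
  eigenvectors.  Both arguments work for any Borel set carrying \<open>E\<close>; taken on the whole plane with the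
  identity function, they show that \<open>\<sigma>(A)\<close> is the support of \<open>E\<close>.
\<close>

subsection \<open>Boundedness in normed spaces\<close>

text \<open>By the Baire category theorem one of the closed sets \<open>C n\<close>, where the whole
  family is bounded by \<open>n\<close>, contains a ball. Subtracting its centre moves the bound to
  a ball around the origin at the cost of a factor 2.\<close>

lemma uniform_boundedness:
  fixes T :: "'i \<Rightarrow> 'a::banach \<Rightarrow>\<^sub>L 'b::real_normed_vector"
  assumes "\<And>x. \<exists>K. \<forall>i\<in>I. norm (T i x) \<le> K"
  shows "\<exists>K. \<forall>i\<in>I. norm (T i) \<le> K"
proof -
  define C where "C n = {x. \<forall>i\<in>I. norm (T i x) \<le> real n}" for n :: nat
  have closed_C: "closed (C n)" for n
    unfolding C_def Collect_ball_eq by (intro closed_INT ballI closed_Collect_le continuous_intros)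
  have "(\<Union>n. C n) = UNIV"
  proof (intro equalityI subsetI UNIV_I)
    fix x
    obtain K where "\<forall>i\<in>I. norm (T i x) \<le> K" using assms by blast
    moreover obtain n where "K \<le> real n" using real_arch_simple by blast
    ultimately have "x \<in> C n" unfolding C_def by force
    then show "x \<in> (\<Union>n. C n)" by blast
  qed
  then have "euclidean interior_of \<Union> (range C) \<noteq> {}" by simp
  then obtain n where "interior (C n) \<noteq> {}"
    using Baire_category_alt[of "euclidean :: 'a topology" "range C"] closed_C
      completely_metrizable_space_euclidean by auto
  then obtain x0 where "x0 \<in> interior (C n)" by blast
  then obtain e where e: "e > 0" "cball x0 e \<subseteq> C n"
    using mem_interior_cball by blast
  have "norm (T i) \<le> 2 * real n / e" if i: "i \<in> I" for i
  proof (rule norm_blinfun_bound)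
    fix x
    show "norm (T i x) \<le> 2 * real n / e * norm x"
    proof (cases "x = 0")
      case False
      define y where "y = (e / norm x) *\<^sub>R x"
      have "norm y = e" using False e(1) by (simp add: y_def)
      then have "x0 + y \<in> C n" "x0 \<in> C n" using e by (auto simp: subset_iff dist_norm)
      then have "norm (T i (x0 + y)) \<le> n" "norm (T i x0) \<le> n" using i by (auto simp: C_def)
      moreover have "T i y = T i (x0 + y) - T i x0" by (simp add: blinfun.add_right)
      ultimately have "norm (T i y) \<le> 2 * real n"
        using norm_triangle_ineq4[of "T i (x0 + y)" "T i x0"] by simp
      then have "(e / norm x) * norm (T i x) \<le> 2 * real n"
        using e(1) by (simp add: y_def blinfun.scaleR_right)
      then show ?thesis using False e(1) by (simp add: field_simps)
    qed (simp add: blinfun.zero_right)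
  qed (use e in simp)
  then show ?thesis by blast
qed

text \<open>
  A sum with coefficients in \<open>[0, 1]\<close> is a convex combination of subsums; this avoids linear
  functionals in the bound of the integral.
\<close>

lemma norm_convex_subsums_le:
  fixes x :: "'i \<Rightarrow> 'b::real_normed_vector"
  assumes "finite I" "\<And>i. i \<in> I \<Longrightarrow> 0 \<le> c i \<and> c i \<le> 1"
    and "\<And>J. J \<subseteq> I \<Longrightarrow> norm (v + sum x J) \<le> K"
  shows "norm (v + (\<Sum>i\<in>I. c i *\<^sub>R x i)) \<le> K"
  using assms
proof (induction I arbitrary: v rule: finite_induct)
  case (insert i I)
  let ?s = "\<Sum>j\<in>I. c j *\<^sub>R x j"
  have sub: "norm (v + sum x J) \<le> K" if "J \<subseteq> I" for J
    using insert.prems(2)[of J] that by blast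
  have sub': "norm ((v + x i) + sum x J) \<le> K" if "J \<subseteq> I" for J
  proof -
    have "finite J" "i \<notin> J" using that insert.hyps finite_subset by auto
    then show ?thesis
      using insert.prems(2)[of "insert i J"] that by (auto simp: add.assoc)
  qed
  have c: "0 \<le> c i" "c i \<le> 1" using insert.prems(1) by auto
  have 1: "norm (v + ?s) \<le> K" by (rule insert.IH) (use insert.prems(1) sub in auto)
  have 2: "norm ((v + x i) + ?s) \<le> K" by (rule insert.IH) (use insert.prems(1) sub' in auto)
  \<comment> \<open>The sum is an average of the one without \<open>x i\<close> and the one with it;
    the free offset \<open>v\<close> absorbs \<open>x i\<close>, so the induction hypothesis covers
    both.\<close>
  have "v + (\<Sum>j\<in>insert i I. c j *\<^sub>R x j) = (1 - c i) *\<^sub>R (v + ?s) + c i *\<^sub>R ((v + x i) + ?s)"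
    using insert.hyps by (simp add: algebra_simps)
  also have "norm \<dots> \<le> (1 - c i) * K + c i * K"
    using c by (intro norm_triangle_le add_mono) (auto intro!: mult_left_mono 1 2)
  finally show ?case by (simp add: algebra_simps)
qed simp

text \<open>The positive and negative parts of \<open>c i / r\<close> lie in [0, 1], so each
  contributes at most \<open>K\<close> by the preceding lemma, whence the factor
  \<open>2 * r\<close>.\<close>

lemma norm_sum_scaleR_le:
  fixes x :: "'i \<Rightarrow> 'b::real_normed_vector"
  assumes fin: "finite I" and r: "r > 0" and c: "\<And>i. i \<in> I \<Longrightarrow> \<bar>c i\<bar> \<le> r"
    and K: "\<And>J. J \<subseteq> I \<Longrightarrow> norm (sum x J) \<le> K"
  shows "norm (\<Sum>i\<in>I. c i *\<^sub>R x i) \<le> 2 * r * K"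
proof -
  \<comment> \<open>The sign \<open>s\<close> serves both parts: 1 selects the positive part, -1 the
    negative one.\<close>
  have *: "norm (\<Sum>i\<in>I. max 0 (s * c i / r) *\<^sub>R x i) \<le> K" if "\<bar>s\<bar> = 1" for s
    using norm_convex_subsums_le[OF fin, where v = 0 and K = K and x = x
        and c = "\<lambda>i. max 0 (s * c i / r)"] K c r that
    by (fastforce simp: field_simps abs_if split: if_splits)
  have "c i *\<^sub>R x i = r *\<^sub>R (max 0 (1 * c i / r) *\<^sub>R x i - max 0 (- 1 * c i / r) *\<^sub>R x i)" for i
    using r by (auto simp: max_def field_simps)
  then have "(\<Sum>i\<in>I. c i *\<^sub>R x i) =
      r *\<^sub>R ((\<Sum>i\<in>I. max 0 (1 * c i / r) *\<^sub>R x i) - (\<Sum>i\<in>I. max 0 (- 1 * c i / r) *\<^sub>R x i))"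
    by (simp add: scaleR_sum_right[symmetric] sum_subtractf)
  also have "norm \<dots> \<le> r * (K + K)"
    unfolding norm_scaleR
    using r norm_triangle_le_diff[OF add_mono[OF *[of 1] *[of "-1"]]] by simp
  finally show ?thesis by simp
qed

text \<open>Real and imaginary parts cost \<open>2 * r * K\<close> each. The vectors enter only
  through the norms of their subsums, so the bound does not grow with the number of terms.\<close>

lemma norm_sum_scaleC_le:
  fixes x :: "'i \<Rightarrow> 'b::complex_normed_vector"
  assumes fin: "finite I" and r: "r > 0" and c: "\<And>i. i \<in> I \<Longrightarrow> cmod (c i) \<le> r"
    and K: "\<And>J. J \<subseteq> I \<Longrightarrow> norm (sum x J) \<le> K"
  shows "norm (\<Sum>i\<in>I. c i *\<^sub>C x i) \<le> 4 * r * K"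
proof -
  interpret C: vector_space "scaleC :: complex \<Rightarrow> 'b \<Rightarrow> 'b" by (rule vector_space_scaleC)
  let ?re = "\<Sum>i\<in>I. Re (c i) *\<^sub>R x i" and ?im = "\<Sum>i\<in>I. Im (c i) *\<^sub>R x i"
  have "c i *\<^sub>C x i = Re (c i) *\<^sub>R x i + \<i> *\<^sub>C (Im (c i) *\<^sub>R x i)" for i
  proof -
    have "c i *\<^sub>C x i = (complex_of_real (Re (c i)) + \<i> * complex_of_real (Im (c i))) *\<^sub>C x i"
      by (simp flip: complex_eq)
    then show ?thesis by (simp add: scaleR_scaleC scaleC_scaleC scaleC_add_left)
  qed
  then have "(\<Sum>i\<in>I. c i *\<^sub>C x i) = ?re + \<i> *\<^sub>C ?im"
    by (simp add: sum.distrib C.scale_sum_right)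
  also have "norm \<dots> \<le> norm ?re + norm ?im"
    using norm_triangle_ineq[of ?re "\<i> *\<^sub>C ?im"] by (simp add: norm_scaleC)
  also have "\<dots> \<le> 2 * r * K + 2 * r * K"
    using c abs_Re_le_cmod abs_Im_le_cmod
    by (intro add_mono norm_sum_scaleR_le[OF fin r _ K]) (blast intro: order_trans)+
  finally show ?thesis by (simp add: mult_ac)
qed

section \<open>Complex linearity and approximation by simple functions\<close>

lemma scaleC_zero_right [simp]: "c *\<^sub>C (0 :: 'a::complex_normed_vector) = 0"
  using norm_scaleC[of c "0 :: 'a"] by simp

lemma scaleC_zero_left [simp]: "0 *\<^sub>C (x :: 'a::complex_normed_vector) = 0"
  using norm_scaleC[of 0 x] by simp

lemma clinear_iff:
  fixes T :: "'a::complex_normed_vector \<Rightarrow> 'b::complex_normed_vector"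
  shows "clinear T \<longleftrightarrow> (\<forall>x y. T (x + y) = T x + T y) \<and> (\<forall>c x. T (c *\<^sub>C x) = c *\<^sub>C T x)"
  by (simp add: clinear_def Vector_Spaces.linear_iff vector_space_scaleC)

lemma clinear_blinfun_iff: "clinear (blinfun_apply T) \<longleftrightarrow> (\<forall>c x. T (c *\<^sub>C x) = c *\<^sub>C T x)"
  by (auto simp: clinear_iff blinfun.add_right)

lemma scaleC_blinfun_compose: "(c *\<^sub>C S) o\<^sub>L T = c *\<^sub>C (S o\<^sub>L T)"
  by (rule blinfun_eqI) (simp add: scaleC_blinfun.rep_eq)

lemma blinfun_compose_scaleC: "clinear (blinfun_apply S) \<Longrightarrow> S o\<^sub>L (c *\<^sub>C T) = c *\<^sub>C (S o\<^sub>L T)"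
  by (rule blinfun_eqI) (simp add: scaleC_blinfun.rep_eq clinear_blinfun_iff)

text \<open>Real and imaginary parts are rounded down to a grid of mesh \<open>1 / Suc n\<close>.
  Boundedness of \<open>G\<close> leaves finitely many grid points as values, and the error is at
  most \<open>2 / Suc n\<close> everywhere.\<close>

lemma bounded_borel_uniform_limit_simple:
  fixes G :: "'a \<Rightarrow> complex"
  assumes G: "G \<in> borel_measurable M" and bd: "bounded (G ` space M)"
  obtains s where "\<And>n::nat. simple_function M (s n)" "uniform_limit (space M) s G sequentially"
proof
  obtain B where B: "\<And>x. x \<in> space M \<Longrightarrow> cmod (G x) \<le> B"
    using bd by (auto simp: bounded_iff)
  define t where "t n z = Complex (\<lfloor>real (Suc n) * Re z\<rfloor> / Suc n) (\<lfloor>real (Suc n) * Im z\<rfloor> / Suc n)" for n z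
  define s where "s n x = t n (G x)" for n x
  show "simple_function M (s n)" for n
  proof -
    let ?I = "{- \<lceil>real (Suc n) * B\<rceil> - 1 .. \<lceil>real (Suc n) * B\<rceil>}"
    have *: "\<lfloor>real (Suc n) * y\<rfloor> \<in> ?I" if "\<bar>y\<bar> \<le> B" for y
    proof -
      have "\<bar>real (Suc n) * y\<bar> \<le> real (Suc n) * B"
        using that unfolding abs_mult by (intro mult_mono) auto
      then show ?thesis by (simp only: atLeastAtMost_iff abs_le_iff) linarith
    qed
    have "s n ` space M \<subseteq> (\<lambda>(i, j). Complex (real_of_int i / Suc n) (real_of_int j / Suc n)) ` (?I \<times> ?I)"
    proof
      fix w assume "w \<in> s n ` space M"
      then obtain x where x: "x \<in> space M" "w = t n (G x)" by (auto simp: s_def)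
      then have "\<bar>Re (G x)\<bar> \<le> B" "\<bar>Im (G x)\<bar> \<le> B"
        using B[of x] abs_Re_le_cmod[of "G x"] abs_Im_le_cmod[of "G x"] by linarith+
      from *[OF this(1)] *[OF this(2)] show "w \<in> (\<lambda>(i, j). Complex (real_of_int i / Suc n) (real_of_int j / Suc n)) ` (?I \<times> ?I)"
        unfolding x(2) t_def by (intro image_eqI[where x = "(_, _)"]) auto
    qed
    then have "finite (s n ` space M)" by (rule finite_subset) simp
    moreover have "s n \<in> borel_measurable M"
      unfolding s_def t_def Complex_eq using G by measurable
    ultimately show ?thesis by (simp add: simple_function_iff_borel_measurable)
  qed
  show "uniform_limit (space M) s G sequentially"
  proof (rule uniform_limitI)
    fix e :: real assume e: "e > 0"
    have *: "\<bar>\<lfloor>real (Suc n) * y\<rfloor> / Suc n - y\<bar> \<le> 1 / real (Suc n)" for n and y :: real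
    proof -
      have "\<bar>real_of_int \<lfloor>real (Suc n) * y\<rfloor> - real (Suc n) * y\<bar> \<le> 1" by linarith
      then have "\<bar>real_of_int \<lfloor>real (Suc n) * y\<rfloor> - real (Suc n) * y\<bar> / real (Suc n) \<le> 1 / real (Suc n)"
        by (rule divide_right_mono) simp
      moreover have "\<lfloor>real (Suc n) * y\<rfloor> / Suc n - y = (\<lfloor>real (Suc n) * y\<rfloor> - real (Suc n) * y) / Suc n"
        by (simp add: diff_divide_distrib del: of_nat_Suc)
      ultimately show ?thesis by simp
    qed
    have d: "cmod (t n z - z) \<le> 2 / Suc n" for n z
      using cmod_le[of "t n z - z"] *[of n "Re z"] *[of n "Im z"] by (simp add: t_def del: of_nat_Suc)
    have "(\<lambda>n. 2 / real (Suc n)) \<longlonglongrightarrow> 0"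
      using tendsto_mult_right[OF LIMSEQ_inverse_real_of_nat, of 2] by (simp add: divide_inverse)
    then have "\<forall>\<^sub>F n in sequentially. 2 / real (Suc n) < e" using e by (rule order_tendstoD)
    then show "\<forall>\<^sub>F n in sequentially. \<forall>x\<in>space M. dist (s n x) (G x) < e"
      by eventually_elim (use d in \<open>auto simp: dist_norm s_def intro: order.strict_trans1\<close>)
  qed
qed

subsection \<open>Spectral measures\<close>

locale spectral_meas =
  fixes E :: "complex set \<Rightarrow> 'a::complex_banach \<Rightarrow>\<^sub>L 'a"
  assumes spectral_measure: "spectral_measure E"
begin

lemma
  shows E_empty [simp]: "E {} = 0"
    and E_UNIV [simp]: "E UNIV = id_blinfun"
    and E_Int: "C \<in> sets borel \<Longrightarrow> D \<in> sets borel \<Longrightarrow> E (C \<inter> D) = E C o\<^sub>L E D"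
    and clinear_E: "D \<in> sets borel \<Longrightarrow> clinear (blinfun_apply (E D))"
  using spectral_measure by (auto simp: spectral_measure_def)

lemma E_sums:
  "range D \<subseteq> sets borel \<Longrightarrow> disjoint_family D \<Longrightarrow> (\<lambda>n::nat. E (D n) f) sums E (\<Union>n. D n) f"
  using spectral_measure by (auto simp: spectral_measure_def)

lemma E_Un:
  assumes "C \<in> sets borel" "D \<in> sets borel" "C \<inter> D = {}"
  shows "E (C \<union> D) = E C + E D"
proof (rule blinfun_eqI)
  fix f
  \<comment> \<open>\<open>binaryset C D\<close> continues with empty sets after \<open>C\<close>
    and \<open>D\<close>, so countable additivity specializes to two sets.\<close>
  have "(\<lambda>n. E (binaryset C D n) f) sums E (\<Union>n. binaryset C D n) f"
    using assms by (intro E_sums)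
      (auto simp: range_binaryset_eq binaryset_def disjoint_family_on_def)
  moreover have "(\<lambda>n. E (binaryset C D n) f) sums (E C f + E D f)"
    by (rule binaryset_sums) simp
  ultimately show "E (C \<union> D) f = (E C + E D) f"
    by (simp add: UN_binaryset_eq sums_unique2 blinfun.add_left)
qed

lemma E_UN:
  assumes "finite I" "\<And>i. i \<in> I \<Longrightarrow> D i \<in> sets borel" "disjoint_family_on D I"
  shows "E (\<Union>i\<in>I. D i) = (\<Sum>i\<in>I. E (D i))"
  using assms
proof (induction I rule: finite_induct)
  case (insert i I)
  have "D i \<inter> (\<Union>j\<in>I. D j) = {}"
    using insert.hyps insert.prems(2) by (auto simp: disjoint_family_on_def)
  moreover have "(\<Union>j\<in>I. D j) \<in> sets borel"
    using insert.hyps insert.prems(1) by (intro sets.finite_UN) auto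
  ultimately have "E (\<Union>j\<in>insert i I. D j) = E (D i) + E (\<Union>j\<in>I. D j)"
    using insert.prems(1) by (simp add: E_Un)
  also have "E (\<Union>j\<in>I. D j) = (\<Sum>j\<in>I. E (D j))"
    using insert.prems by (intro insert.IH) (auto simp: disjoint_family_on_def)
  finally show ?case using insert.hyps by simp
qed simp

lemma E_null_subset:
  assumes "C \<in> sets borel" "D \<in> sets borel" "C \<subseteq> D" "E D = 0"
  shows "E C = 0"
  using E_Int[of C D] assms by (simp add: Int_absorb2)

lemma E_Diff_null:
  assumes "C \<in> sets borel" "N \<in> sets borel" "E N = 0"
  shows "E (C - N) = E C"
proof -
  have "E (C \<inter> N) = 0" using E_null_subset[of "C \<inter> N" N] assms by auto
  then show ?thesis
    using E_Un[of "C - N" "C \<inter> N"] assms by (simp add: Un_Diff_Int Int_commute[of "C - N"] Int_Diff_disjoint)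
qed

lemma E_UN_null:
  fixes D :: "nat \<Rightarrow> complex set"
  assumes "\<And>n. D n \<in> sets borel" "\<And>n. E (D n) = 0"
  shows "E (\<Union>n. D n) = 0"
proof (rule blinfun_eqI)
  fix f
  have D: "disjointed D n \<in> sets borel" for n
    using assms(1) sets.range_disjointed_sets[of D borel] by auto
  then have "(\<lambda>n. E (disjointed D n) f) sums E (\<Union>n. disjointed D n) f"
    by (intro E_sums disjoint_family_disjointed) auto
  moreover have "E (disjointed D n) = 0" for n
    using E_null_subset[OF D assms(1) disjointed_subset assms(2)] .
  ultimately show "E (\<Union>n. D n) f = (0 :: 'a \<Rightarrow>\<^sub>L 'a) f"
    by (simp add: UN_disjointed_eq sums_unique2[OF _ sums_zero])
qed

text \<open>Countable additivity is applied to the differences of successive sets, whose partial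
  sums telescope to \<open>E (D n)\<close>. This strong continuity later removes the truncation of
  an unbounded function.\<close>

lemma E_incseq_LIMSEQ:
  fixes D :: "nat \<Rightarrow> complex set"
  assumes "incseq D" "\<And>n. D n \<in> sets borel"
  shows "(\<lambda>n. E (D n) f) \<longlonglongrightarrow> E (\<Union>n. D n) f"
proof -
  have D: "disjointed D n \<in> sets borel" for n
    using assms(2) sets.range_disjointed_sets[of D borel] by auto
  then have "(\<lambda>n. E (disjointed D n) f) sums E (\<Union>n. disjointed D n) f"
    by (intro E_sums disjoint_family_disjointed) auto
  then have *: "(\<lambda>n. \<Sum>i\<le>n. E (disjointed D i) f) \<longlonglongrightarrow> E (\<Union>n. D n) f"
    by (simp add: sums_def_le UN_disjointed_eq)
  have "(\<Sum>i\<le>n. E (disjointed D i) f) = E (D n) f" for n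
  proof -
    have "(\<Union>i\<in>{..n}. disjointed D i) = (\<Union>i\<in>{..n}. D i)"
      using finite_UN_disjointed_eq[of D "Suc n"] by (simp add: atLeast0LessThan lessThan_Suc_atMost)
    also have "\<dots> = D n"
      using \<open>incseq D\<close> by (auto simp: incseq_def)
    finally have "(\<Union>i\<in>{..n}. disjointed D i) = D n" .
    then have "E (D n) = (\<Sum>i\<le>n. E (disjointed D i))"
      using E_UN[of "{..n}" "disjointed D"] D disjoint_family_disjointed[of D]
      by (auto simp: disjoint_family_on_def)
    then show ?thesis by (simp add: blinfun.sum_left)
  qed
  with * show ?thesis by simp
qed

text \<open>
  If \<open>B \<mapsto> E B f\<close> were unbounded, then repeatedly splitting off a piece on which it is large,
  while keeping it unbounded on the rest, would give disjoint sets whose values do not tend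
  to \<open>0\<close>.
\<close>

lemma E_pointwise_bounded: "\<exists>K. \<forall>D\<in>sets borel. norm (E D f) \<le> K"
proof (rule ccontr)
  define unb where "unb D \<longleftrightarrow> D \<in> sets borel \<and>
    (\<forall>K. \<exists>B\<in>sets borel. B \<subseteq> D \<and> norm (E B f) > K)" for D
  assume "\<not> ?thesis"
  then have "unb UNIV" by (auto simp: unb_def not_le)
  have step: "\<exists>D'. unb D' \<and> D' \<subseteq> D \<and> norm (E (D - D') f) \<ge> 1" if D: "unb D" for D
  proof -
    have D_borel: "D \<in> sets borel" using D by (simp add: unb_def)
    \<comment> \<open>The threshold \<open>norm (E D f) + 1\<close> makes both \<open>E B f\<close>
      and \<open>E (D - B) f\<close> at least 1 in norm, so either piece may be the one split
      off.\<close>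
    obtain B where B: "B \<in> sets borel" "B \<subseteq> D" "norm (E B f) > norm (E D f) + 1"
      using D unfolding unb_def by blast
    have "E D = E B + E (D - B)"
      using E_Un[of B "D - B"] B D_borel by (simp add: Un_absorb1)
    then have "E (D - B) f = E D f - E B f" by (simp add: blinfun.add_left)
    then have large: "norm (E (D - B) f) \<ge> 1"
      using B(3) norm_triangle_ineq2[of "E B f" "E D f"] by (simp add: norm_minus_commute)
    \<comment> \<open>If both pieces were bounded, by \<open>K1\<close> and \<open>K2\<close>,
      additivity would bound all subsets of \<open>D\<close> by \<open>K1 + K2\<close>.\<close>
    have "unb B \<or> unb (D - B)"
    proof (rule ccontr)
      assume "\<not> (unb B \<or> unb (D - B))"
      then have "\<not> unb B" "\<not> unb (D - B)" by blast+
      moreover have "D - B \<in> sets borel" using B(1) D_borel by blast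
      ultimately have "\<exists>K. \<forall>C\<in>sets borel. C \<subseteq> B \<longrightarrow> norm (E C f) \<le> K"
        "\<exists>K. \<forall>C\<in>sets borel. C \<subseteq> D - B \<longrightarrow> norm (E C f) \<le> K"
        using B(1) by (simp_all add: unb_def not_less imp_conjL)
      then obtain K1 K2 where K: "\<And>C. C \<in> sets borel \<Longrightarrow> C \<subseteq> B \<Longrightarrow> norm (E C f) \<le> K1"
        "\<And>C. C \<in> sets borel \<Longrightarrow> C \<subseteq> D - B \<Longrightarrow> norm (E C f) \<le> K2"
        by meson
      obtain C where C: "C \<in> sets borel" "C \<subseteq> D" "norm (E C f) > K1 + K2"
        using D unfolding unb_def by blast
      have "E C = E (C \<inter> B) + E (C - B)"
        using E_Un[of "C \<inter> B" "C - B"] B C by (simp add: Int_Diff_Un Int_Diff_disjoint)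
      then have "E C f = E (C \<inter> B) f + E (C - B) f" by (simp add: blinfun.add_left)
      moreover have "norm (E (C \<inter> B) f) \<le> K1" "norm (E (C - B) f) \<le> K2"
        using B C by (auto intro!: K)
      ultimately show False
        using C(3) norm_triangle_ineq[of "E (C \<inter> B) f" "E (C - B) f"] by simp
    qed
    then show ?thesis
    proof
      assume "unb B"
      then show ?thesis using large B by blast
    next
      assume "unb (D - B)"
      moreover have "D - (D - B) = B" using B by blast
      moreover have "1 \<le> norm (E B f)" using B(3) norm_ge_zero[of "E D f"] by linarith
      ultimately show ?thesis using B by (metis Diff_subset)
    qed
  qed
  have "\<exists>D. \<forall>n::nat. unb (D n) \<and> (D (Suc n) \<subseteq> D n \<and> norm (E (D n - D (Suc n)) f) \<ge> 1)"
    using \<open>unb UNIV\<close> step by (intro dependent_nat_choice) auto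
  then obtain D where D: "\<And>n::nat. unb (D n)" "\<And>n. D (Suc n) \<subseteq> D n"
    "\<And>n. norm (E (D n - D (Suc n)) f) \<ge> 1"
    by auto
  have "disjoint_family (\<lambda>n. D n - D (Suc n))"
  proof -
    have "D n \<subseteq> D (Suc m)" if "m < n" for m n
      using lift_Suc_antimono_le[of D "Suc m" n] D(2) that by auto
    then have "(D m - D (Suc m)) \<inter> (D n - D (Suc n)) = {}" if "m < n" for m n
      using that by blast
    then show ?thesis
      unfolding disjoint_family_on_def by (metis Int_commute linorder_neqE_nat)
  qed
  \<comment> \<open>The pieces split off are disjoint, so their values form a convergent series and
    tend to 0, against the lower bound 1.\<close>
  then have "(\<lambda>n. E (D n - D (Suc n)) f) sums E (\<Union>n. D n - D (Suc n)) f"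
    using D(1) by (intro E_sums) (auto simp: unb_def)
  then have "(\<lambda>n. E (D n - D (Suc n)) f) \<longlonglongrightarrow> 0"
    by (intro summable_LIMSEQ_zero sums_summable)
  then have "\<forall>\<^sub>F n in sequentially. norm (E (D n - D (Suc n)) f) < 1"
    using tendsto_norm_zero order_tendstoD(2) zero_less_one by blast
  then show False
    using D(3) by (auto simp: eventually_sequentially not_less[symmetric])
qed

definition bound :: real where
  "bound = (SOME K. K \<ge> 0 \<and> (\<forall>D\<in>sets borel. norm (E D) \<le> K))"

text \<open>The uniform boundedness principle turns the bound at each vector into a single bound on
  the operator norms; all estimates of integrals rest on it.\<close>

lemma bound_nonneg: "bound \<ge> 0"
  and norm_E_le: "D \<in> sets borel \<Longrightarrow> norm (E D) \<le> bound"
proof -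
  obtain K where "\<forall>D\<in>sets borel. norm (E D) \<le> K"
    using uniform_boundedness[of "sets borel" E] E_pointwise_bounded by blast
  then have "\<exists>K. K \<ge> 0 \<and> (\<forall>D\<in>sets borel. norm (E D) \<le> K)"
    by (intro exI[of _ "max K 0"]) (auto simp: le_max_iff_disj)
  from someI_ex[OF this] show "bound \<ge> 0" "D \<in> sets borel \<Longrightarrow> norm (E D) \<le> bound"
    unfolding bound_def by blast+
qed

end

subsection \<open>Integrals of simple functions\<close>

text \<open>The condition \<open>E S = id_blinfun\<close> expresses that the complement of
  \<open>S\<close> is null. The carrier stays arbitrary because it is instantiated both by the whole
  plane and by \<open>spectrum A\<close>.\<close>

locale spectral_meas_on = spectral_meas E
  for E :: "complex set \<Rightarrow> 'a::complex_banach \<Rightarrow>\<^sub>L 'a" +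
  fixes S :: "complex set"
  assumes S_borel [measurable, simp]: "S \<in> sets borel"
    and E_S [simp]: "E S = id_blinfun"
begin

abbreviation "borel\<^sub>S \<equiv> restrict_space (borel :: complex measure) S"

lemma space_borel_S [simp]: "space borel\<^sub>S = S"
  by (simp add: space_restrict_space)

lemma sets_borel_S: "D \<in> sets borel\<^sub>S \<longleftrightarrow> D \<subseteq> S \<and> D \<in> sets borel"
  by (simp add: sets_restrict_space_iff)

lemma E_subset_S:
  assumes "D \<in> sets borel"
  shows "E (D \<inter> S) = E D"
  using E_Int[OF assms S_borel] by (auto intro: blinfun_eqI)

lemma simple_vimage_borel: "simple_function borel\<^sub>S t \<Longrightarrow> t -` Y \<inter> S \<in> sets borel"
  using simple_functionD(2)[of borel\<^sub>S t Y] by (simp add: sets_borel_S)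

lemma simple_finite: "simple_function borel\<^sub>S t \<Longrightarrow> finite (t ` S)"
  using simple_functionD(1)[of borel\<^sub>S t] by simp

text \<open>Any subsum of the projections in a simple integral is again a single value of
  \<open>E\<close>, hence bounded by \<open>bound\<close>; this is the hypothesis of
  \<open>norm_sum_scaleC_le\<close>.\<close>

lemma E_simple_vimage:
  assumes "simple_function borel\<^sub>S t" "J \<subseteq> t ` S"
  shows "E (t -` J \<inter> S) = (\<Sum>y\<in>J. E (t -` {y} \<inter> S))"
proof -
  have "t -` J \<inter> S = (\<Union>y\<in>J. t -` {y} \<inter> S)" by auto
  also have "E \<dots> = (\<Sum>y\<in>J. E (t -` {y} \<inter> S))"
    using assms simple_finite[OF assms(1)]
    by (intro E_UN simple_vimage_borel) (auto simp: disjoint_family_on_def finite_subset)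
  finally show ?thesis .
qed

text \<open>\<open>simple_integral\<close> sums over distinct values and so merges level sets on
  which \<phi> agrees. Here it is computed on the finer partition given by \<open>t\<close>; with a
  pair of functions for \<open>t\<close>, sums and products get a common partition.\<close>

lemma simple_integral_comp:
  assumes t: "simple_function borel\<^sub>S t"
  shows "simple_integral E S (\<lambda>z. \<phi> (t z)) = (\<Sum>y\<in>t ` S. \<phi> y *\<^sub>C E (t -` {y} \<inter> S))"
proof -
  interpret C: vector_space "scaleC :: complex \<Rightarrow> ('a \<Rightarrow>\<^sub>L 'a) \<Rightarrow> _"
    by (rule vector_space_scaleC)
  have "w *\<^sub>C E ((\<lambda>z. \<phi> (t z)) -` {w} \<inter> S) =
      (\<Sum>y\<in>{y \<in> t ` S. \<phi> y = w}. \<phi> y *\<^sub>C E (t -` {y} \<inter> S))" for w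
  proof -
    have "(\<lambda>z. \<phi> (t z)) -` {w} \<inter> S = t -` {y \<in> t ` S. \<phi> y = w} \<inter> S" by auto
    then have "E ((\<lambda>z. \<phi> (t z)) -` {w} \<inter> S) = (\<Sum>y\<in>{y \<in> t ` S. \<phi> y = w}. E (t -` {y} \<inter> S))"
      using E_simple_vimage[OF t, of "{y \<in> t ` S. \<phi> y = w}"] by auto
    then show ?thesis by (simp add: C.scale_sum_right)
  qed
  then have "simple_integral E S (\<lambda>z. \<phi> (t z)) =
      (\<Sum>w\<in>\<phi> ` t ` S. \<Sum>y\<in>{y \<in> t ` S. \<phi> y = w}. \<phi> y *\<^sub>C E (t -` {y} \<inter> S))"
    by (simp add: simple_integral_def image_image)
  also have "\<dots> = (\<Sum>y\<in>t ` S. \<phi> y *\<^sub>C E (t -` {y} \<inter> S))"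
    using simple_finite[OF t] by (intro sum.group) auto
  finally show ?thesis .
qed

lemma simple_integral_add:
  assumes s: "simple_function borel\<^sub>S s" and t: "simple_function borel\<^sub>S t"
  shows "simple_integral E S (\<lambda>z. s z + t z) = simple_integral E S s + simple_integral E S t"
proof -
  let ?p = "\<lambda>z. (s z, t z)"
  have p: "simple_function borel\<^sub>S ?p" using s t by (rule simple_function_Pair)
  show ?thesis
    using simple_integral_comp[OF p, of "\<lambda>y. fst y + snd y"]
      simple_integral_comp[OF p, of fst] simple_integral_comp[OF p, of snd]
    by (simp add: scaleC_add_left sum.distrib)
qed

lemma simple_integral_diff:
  assumes s: "simple_function borel\<^sub>S s" and t: "simple_function borel\<^sub>S t"
  shows "simple_integral E S (\<lambda>z. s z - t z) = simple_integral E S s - simple_integral E S t"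
  using simple_integral_add[OF simple_function_diff[OF s t] t] by simp

text \<open>Distinct level sets of the pair are disjoint, so their projections multiply to 0 and the
  double sum collapses to its diagonal.\<close>

lemma simple_integral_mult:
  assumes s: "simple_function borel\<^sub>S s" and t: "simple_function borel\<^sub>S t"
  shows "simple_integral E S (\<lambda>z. s z * t z) = simple_integral E S s o\<^sub>L simple_integral E S t"
proof -
  let ?p = "\<lambda>z. (s z, t z)"
  let ?B = "\<lambda>y. ?p -` {y} \<inter> S"
  have p: "simple_function borel\<^sub>S ?p" using s t by (rule simple_function_Pair)
  note B = simple_vimage_borel[OF p]
  have fin: "finite (?p ` S)" using simple_finite[OF p] .
  have prod: "E (?B x) o\<^sub>L E (?B y) = (if x = y then E (?B x) else 0)" for x y
  proof -
    have "?B x \<inter> ?B y = (if x = y then ?B x else {})" by auto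
    then show ?thesis using E_Int[OF B B, of "{x}" "{y}"] by (auto split: if_splits)
  qed
  have "simple_integral E S s o\<^sub>L simple_integral E S t =
      (\<Sum>x\<in>?p ` S. fst x *\<^sub>C E (?B x)) o\<^sub>L (\<Sum>y\<in>?p ` S. snd y *\<^sub>C E (?B y))"
    using simple_integral_comp[OF p, of fst] simple_integral_comp[OF p, of snd] by simp
  also have "\<dots> = (\<Sum>x\<in>?p ` S. \<Sum>y\<in>?p ` S. (fst x *\<^sub>C E (?B x)) o\<^sub>L (snd y *\<^sub>C E (?B y)))"
    by (simp add: bounded_bilinear.sum_left[OF bounded_bilinear_blinfun_compose]
        bounded_bilinear.sum_right[OF bounded_bilinear_blinfun_compose]) (rule sum.swap)
  also have "\<dots> = (\<Sum>x\<in>?p ` S. \<Sum>y\<in>?p ` S. if x = y then (fst x * snd x) *\<^sub>C E (?B x) else 0)"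
  proof (intro sum.cong refl)
    fix x y
    have "(fst x *\<^sub>C E (?B x)) o\<^sub>L (snd y *\<^sub>C E (?B y)) = (fst x * snd y) *\<^sub>C (E (?B x) o\<^sub>L E (?B y))"
      by (simp add: scaleC_blinfun_compose blinfun_compose_scaleC clinear_E B scaleC_scaleC)
    also have "\<dots> = (if x = y then (fst x * snd x) *\<^sub>C E (?B x) else 0)"
      unfolding prod by simp
    finally show "(fst x *\<^sub>C E (?B x)) o\<^sub>L (snd y *\<^sub>C E (?B y)) =
      (if x = y then (fst x * snd x) *\<^sub>C E (?B x) else 0)" .
  qed
  also have "\<dots> = (\<Sum>x\<in>?p ` S. (fst x * snd x) *\<^sub>C E (?B x))"
    using fin by (simp add: sum.delta)
  also have "\<dots> = simple_integral E S (\<lambda>z. s z * t z)"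
    using simple_integral_comp[OF p, of "\<lambda>y. fst y * snd y"] by simp
  finally show ?thesis ..
qed

lemma simple_integral_const: "simple_integral E S (\<lambda>_. c) = c *\<^sub>C id_blinfun"
  using simple_integral_comp[of "\<lambda>_. ()" "\<lambda>_. c"]
  \<comment> \<open>For empty \<open>S\<close> the sum is empty, and the identity \<open>E S\<close>
    is \<open>E {} = 0\<close>.\<close>
  by (cases "S = {}") (use E_S in \<open>auto simp: vimage_def image_constant_conv simple_integral_def\<close>)

lemma simple_integral_indicator:
  assumes D: "D \<in> sets borel"
  shows "simple_integral E S (indicator D) = E D"
proof -
  have t: "simple_function borel\<^sub>S (\<lambda>z. z \<in> D)"
    unfolding simple_function_def
  proof (intro conjI ballI)
    fix b :: bool
    have "(\<lambda>z. z \<in> D) -` {b} \<inter> S = (if b then D \<inter> S else S - D)" by auto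
    then show "(\<lambda>z. z \<in> D) -` {b} \<inter> space borel\<^sub>S \<in> sets borel\<^sub>S"
      using D by (simp add: sets_borel_S)
  qed auto
  have "simple_integral E S (indicator D) =
      (\<Sum>y\<in>(\<lambda>z. z \<in> D) ` S. of_bool y *\<^sub>C E ((\<lambda>z. z \<in> D) -` {y} \<inter> S))"
    using simple_integral_comp[OF t, of of_bool] by (simp add: indicator_def[abs_def])
  \<comment> \<open>A truth value that is not attained on \<open>S\<close> has an empty level set
    and adds nothing, so the sum may run over both values.\<close>
  also have "\<dots> = (\<Sum>y\<in>UNIV. of_bool y *\<^sub>C E ((\<lambda>z. z \<in> D) -` {y} \<inter> S))"
  proof (rule sum.mono_neutral_left)
    have "E ((\<lambda>z. z \<in> D) -` {y} \<inter> S) = 0" if "y \<notin> (\<lambda>z. z \<in> D) ` S" for y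
    proof -
      have "(\<lambda>z. z \<in> D) -` {y} \<inter> S = {}" using that by auto
      then show ?thesis by simp
    qed
    then show "\<forall>y\<in>UNIV - (\<lambda>z. z \<in> D) ` S. of_bool y *\<^sub>C E ((\<lambda>z. z \<in> D) -` {y} \<inter> S) = 0"
      by simp
  qed auto
  also have "\<dots> = E (D \<inter> S)"
    by (simp add: UNIV_bool scaleC_one vimage_def Int_def)
  finally show ?thesis using E_subset_S[OF D] by simp
qed

lemma norm_simple_integral_le:
  assumes s: "simple_function borel\<^sub>S s" and r: "r \<ge> 0" "\<And>z. z \<in> S \<Longrightarrow> cmod (s z) \<le> r"
  shows "norm (simple_integral E S s) \<le> 4 * r * bound"
\<comment> \<open>The estimate for sums divides by \<open>r\<close>; for \<open>r = 0\<close> the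
  integral vanishes outright.\<close>
proof (cases "r = 0")
  case True
  then have "s ` S \<subseteq> {0}" using r by auto
  have "simple_integral E S s = 0"
    unfolding simple_integral_def using \<open>s ` S \<subseteq> {0}\<close> by (intro sum.neutral) auto
  then show ?thesis using True by simp
next
  case False
  show ?thesis
    unfolding simple_integral_def
  proof (rule norm_sum_scaleC_le)
    show "norm (\<Sum>y\<in>J. E (s -` {y} \<inter> S)) \<le> bound" if "J \<subseteq> s ` S" for J
      using norm_E_le[OF simple_vimage_borel[OF s]] by (simp flip: E_simple_vimage[OF s that])
  qed (use r False simple_finite[OF s] in auto)
qed

lemma clinear_simple_integral:
  assumes s: "simple_function borel\<^sub>S s"
  shows "clinear (blinfun_apply (simple_integral E S s))"
proof -
  interpret C: vector_space "scaleC :: complex \<Rightarrow> 'a \<Rightarrow> 'a" by (rule vector_space_scaleC)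
  have "E (s -` {y} \<inter> S) (c *\<^sub>C x) = c *\<^sub>C E (s -` {y} \<inter> S) x" for y c x
    using clinear_E[OF simple_vimage_borel[OF s]] by (simp add: clinear_blinfun_iff)
  then show ?thesis
    by (simp add: clinear_blinfun_iff simple_integral_def blinfun.sum_left scaleC_blinfun.rep_eq
        C.scale_sum_right mult.commute)
qed

subsection \<open>Integrals of bounded functions\<close>

lemma norm_simple_integral_diff_le:
  assumes "simple_function borel\<^sub>S s" "simple_function borel\<^sub>S t"
    and "r \<ge> 0" "\<And>z. z \<in> S \<Longrightarrow> dist (s z) (t z) \<le> r"
  shows "norm (simple_integral E S s - simple_integral E S t) \<le> 4 * r * bound"
  using norm_simple_integral_le[OF simple_function_diff[OF assms(1,2)] assms(3)] assms
  by (simp add: simple_integral_diff dist_norm)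

text \<open>Two sequences with the same uniform limit are eventually uniformly close to each other.
  This makes the integral of a bounded function independent of the approximation.\<close>

lemma simple_integral_diff_tendsto_0:
  assumes s: "\<And>n. simple_function borel\<^sub>S (s n)" and t: "\<And>n. simple_function borel\<^sub>S (t n)"
    and "uniform_limit S s G sequentially" "uniform_limit S t G sequentially"
  shows "(\<lambda>n. simple_integral E S (s n) - simple_integral E S (t n)) \<longlonglongrightarrow> 0"
proof (rule tendstoI)
  fix e :: real assume "e > 0"
  \<comment> \<open>Both sequences lie within \<open>d\<close> of \<open>G\<close>, hence within
    \<open>2 * d\<close> of each other; the summand 1 in the denominator keeps the bound strict and
    covers \<open>bound = 0\<close>.\<close>
  define d where "d = e / (2 * (4 * bound + 1))"
  have d: "d > 0" "4 * (2 * d) * bound < e"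
    using \<open>e > 0\<close> bound_nonneg by (simp_all add: d_def field_simps)
  show "\<forall>\<^sub>F n in sequentially. dist (simple_integral E S (s n) - simple_integral E S (t n)) 0 < e"
    using uniform_limitD[OF assms(3) d(1)] uniform_limitD[OF assms(4) d(1)]
  proof eventually_elim
    case (elim n)
    have "dist (s n z) (t n z) \<le> 2 * d" if "z \<in> S" for z
      using dist_triangle2[of "s n z" "t n z" "G z"] elim that by fastforce
    then have "norm (simple_integral E S (s n) - simple_integral E S (t n)) \<le> 4 * (2 * d) * bound"
      using d(1) by (intro norm_simple_integral_diff_le s t) auto
    then show ?case using d(2) by simp
  qed
qed

text \<open>This justifies the definite description in \<open>bounded_integral\<close>: the
  integrals are Cauchy by the norm estimate, the operator space is complete, and the limit does not
  depend on the sequence.\<close>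

lemma bounded_integral_LIMSEQ:
  assumes s: "\<And>n. simple_function borel\<^sub>S (s n)" and lim: "uniform_limit S s G sequentially"
  shows "(\<lambda>n. simple_integral E S (s n)) \<longlonglongrightarrow> bounded_integral E S G"
proof -
  let ?P = "\<lambda>T. \<forall>t. (\<forall>n. simple_function borel\<^sub>S (t n)) \<longrightarrow> uniform_limit S t G sequentially \<longrightarrow>
    (\<lambda>n. simple_integral E S (t n)) \<longlonglongrightarrow> T"
  have "Cauchy (\<lambda>n. simple_integral E S (s n))"
  proof (rule metric_CauchyI)
    fix e :: real assume "e > 0"
    define d where "d = e / (2 * (4 * bound + 1))"
    have d: "d > 0" "4 * (2 * d) * bound < e"
      using \<open>e > 0\<close> bound_nonneg by (simp_all add: d_def field_simps)
    obtain M where M: "\<And>n z. n \<ge> M \<Longrightarrow> z \<in> S \<Longrightarrow> dist (s n z) (G z) < d"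
      using uniform_limitD[OF lim d(1)] by (auto simp: eventually_sequentially)
    have "dist (simple_integral E S (s m)) (simple_integral E S (s n)) < e"
      if "m \<ge> M" "n \<ge> M" for m n
    proof -
      have "dist (s m z) (s n z) \<le> 2 * d" if "z \<in> S" for z
        using dist_triangle2[of "s m z" "s n z" "G z"] M[OF \<open>m \<ge> M\<close> that] M[OF \<open>n \<ge> M\<close> that]
        by linarith
      then have "norm (simple_integral E S (s m) - simple_integral E S (s n)) \<le> 4 * (2 * d) * bound"
        using d(1) by (intro norm_simple_integral_diff_le s) auto
      then show ?thesis using d(2) by (simp add: dist_norm)
    qed
    then show "\<exists>M. \<forall>m\<ge>M. \<forall>n\<ge>M. dist (simple_integral E S (s m)) (simple_integral E S (s n)) < e"
      by blast
  qed
  then obtain T where T: "(\<lambda>n. simple_integral E S (s n)) \<longlonglongrightarrow> T"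
    using Cauchy_convergent convergent_def by blast
  have "?P T"
  proof (intro allI impI)
    fix t assume t: "\<forall>n. simple_function borel\<^sub>S (t n)" "uniform_limit S t G sequentially"
    have "(\<lambda>n. simple_integral E S (s n) - (simple_integral E S (s n) - simple_integral E S (t n)))
      \<longlonglongrightarrow> T - 0"
      using t by (intro tendsto_diff T simple_integral_diff_tendsto_0[OF s _ lim]) auto
    then show "(\<lambda>n. simple_integral E S (t n)) \<longlonglongrightarrow> T" by simp
  qed
  \<comment> \<open>The given sequence \<open>s\<close> pins down the limit; with no approximating
    sequence the condition would hold for every operator.\<close>
  moreover have "T' = T" if "?P T'" for T'
    using that s lim T LIMSEQ_unique by blast
  ultimately have "bounded_integral E S G = T"
    unfolding bounded_integral_def by (rule the_equality)
  with T show ?thesis by simp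
qed

section \<open>The calculus of bounded Borel functions\<close>

definition bounded_borel :: "(complex \<Rightarrow> complex) \<Rightarrow> bool"
  where "bounded_borel G \<longleftrightarrow> G \<in> borel_measurable borel\<^sub>S \<and> bounded (G ` S)"

lemma bounded_borelI:
  "G \<in> borel_measurable borel\<^sub>S \<Longrightarrow> (\<And>z. z \<in> S \<Longrightarrow> cmod (G z) \<le> r) \<Longrightarrow> bounded_borel G"
  by (auto simp: bounded_borel_def bounded_iff)

lemma bounded_borel_approx:
  assumes "bounded_borel G"
  obtains s where "\<And>n::nat. simple_function borel\<^sub>S (s n)" "uniform_limit S s G sequentially"
  using assms bounded_borel_uniform_limit_simple[of G borel\<^sub>S] by (auto simp: bounded_borel_def)

lemma bounded_borel_const: "bounded_borel (\<lambda>_. c)"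
  by (rule bounded_borelI[where r = "cmod c"]) auto

lemma bounded_borel_indicator: "D \<in> sets borel \<Longrightarrow> bounded_borel (indicator D)"
  by (rule bounded_borelI[where r = 1])
    (auto simp: indicator_def intro!: measurable_restrict_space1)

lemma bounded_borel_mult:
  assumes "bounded_borel G" "bounded_borel H"
  shows "bounded_borel (\<lambda>z. G z * H z)"
proof -
  obtain a b where "\<And>z. z \<in> S \<Longrightarrow> cmod (G z) \<le> a" "\<And>z. z \<in> S \<Longrightarrow> cmod (H z) \<le> b"
    using assms by (auto simp: bounded_borel_def bounded_iff)
  then have "cmod (G z * H z) \<le> a * b" if "z \<in> S" for z
    unfolding norm_mult using that by (intro mult_mono) (auto intro: order_trans[OF norm_ge_zero])
  then show ?thesis
    using assms by (intro bounded_borelI[where r = "a * b"]) (auto simp: bounded_borel_def)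
qed

lemma bounded_integral_cong:
  assumes "\<And>z. z \<in> S \<Longrightarrow> G z = H z"
  shows "bounded_integral E S G = bounded_integral E S H"
proof -
  have "uniform_limit S s G sequentially \<longleftrightarrow> uniform_limit S s H sequentially"
    for s :: "nat \<Rightarrow> complex \<Rightarrow> complex"
    using assms by (intro uniform_limit_cong) auto
  then show ?thesis by (simp add: bounded_integral_def)
qed

lemma bounded_integral_add:
  assumes "bounded_borel G" "bounded_borel H"
  shows "bounded_integral E S (\<lambda>z. G z + H z) = bounded_integral E S G + bounded_integral E S H"
proof -
  obtain s where s: "\<And>n::nat. simple_function borel\<^sub>S (s n)" "uniform_limit S s G sequentially"
    using assms(1) by (rule bounded_borel_approx) blast
  obtain t where t: "\<And>n::nat. simple_function borel\<^sub>S (t n)" "uniform_limit S t H sequentially"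
    using assms(2) by (rule bounded_borel_approx) blast
  have "(\<lambda>n. simple_integral E S (\<lambda>z. s n z + t n z)) \<longlonglongrightarrow> bounded_integral E S (\<lambda>z. G z + H z)"
    using s t by (intro bounded_integral_LIMSEQ uniform_limit_add) auto
  moreover have "(\<lambda>n. simple_integral E S (\<lambda>z. s n z + t n z))
      \<longlonglongrightarrow> bounded_integral E S G + bounded_integral E S H"
    unfolding simple_integral_add[OF s(1) t(1)] by (intro tendsto_add bounded_integral_LIMSEQ s t)
  ultimately show ?thesis by (rule LIMSEQ_unique)
qed

lemma bounded_integral_mult:
  assumes "bounded_borel G" "bounded_borel H"
  shows "bounded_integral E S (\<lambda>z. G z * H z) = bounded_integral E S G o\<^sub>L bounded_integral E S H"
proof -
  obtain s where s: "\<And>n::nat. simple_function borel\<^sub>S (s n)" "uniform_limit S s G sequentially"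
    using assms(1) by (rule bounded_borel_approx) blast
  obtain t where t: "\<And>n::nat. simple_function borel\<^sub>S (t n)" "uniform_limit S t H sequentially"
    using assms(2) by (rule bounded_borel_approx) blast
  have "(\<lambda>n. simple_integral E S (\<lambda>z. s n z * t n z)) \<longlonglongrightarrow> bounded_integral E S (\<lambda>z. G z * H z)"
    using s t assms
    \<comment> \<open>Uniform convergence passes to products because both limits are bounded on
      \<open>S\<close>.\<close>
    by (intro bounded_integral_LIMSEQ uniform_lim_mult) (auto simp: bounded_borel_def)
  moreover have "(\<lambda>n. simple_integral E S (\<lambda>z. s n z * t n z))
      \<longlonglongrightarrow> (bounded_integral E S G o\<^sub>L bounded_integral E S H)"
    unfolding simple_integral_mult[OF s(1) t(1)]
    by (intro bounded_bilinear.tendsto[OF bounded_bilinear_blinfun_compose]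
        bounded_integral_LIMSEQ s t)
  ultimately show ?thesis by (rule LIMSEQ_unique)
qed

lemma bounded_integral_simple:
  assumes "simple_function borel\<^sub>S s"
  shows "bounded_integral E S s = simple_integral E S s"
proof -
  have "(\<lambda>n::nat. simple_integral E S s) \<longlonglongrightarrow> bounded_integral E S s"
    using assms by (intro bounded_integral_LIMSEQ uniform_limit_const)
  then show ?thesis by (simp add: LIMSEQ_const_iff)
qed

lemma bounded_integral_cmult:
  assumes "bounded_borel G"
  shows "bounded_integral E S (\<lambda>z. c * G z) = c *\<^sub>C bounded_integral E S G"
proof -
  have "bounded_integral E S (\<lambda>_. c) = c *\<^sub>C id_blinfun"
    by (simp add: bounded_integral_simple simple_integral_const)
  then have "bounded_integral E S (\<lambda>z. c * G z) = (c *\<^sub>C id_blinfun) o\<^sub>L bounded_integral E S G"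
    using bounded_integral_mult[OF bounded_borel_const[of c] assms] by simp
  then show ?thesis
    by (auto intro!: blinfun_eqI simp: scaleC_blinfun.rep_eq)
qed

lemma bounded_integral_indicator:
  assumes "D \<in> sets borel"
  shows "bounded_integral E S (indicator D) = E D"
proof -
  have "(indicator D :: complex \<Rightarrow> complex) \<in> borel_measurable borel\<^sub>S"
    using bounded_borel_indicator[OF assms] by (simp add: bounded_borel_def)
  moreover have "finite (indicator D ` S :: complex set)"
    by (rule finite_subset[of _ "{0, 1}"]) (auto simp: indicator_def)
  ultimately have "simple_function borel\<^sub>S (indicator D :: complex \<Rightarrow> complex)"
    by (simp add: simple_function_iff_borel_measurable)
  then show ?thesis
    using assms by (simp add: bounded_integral_simple simple_integral_indicator)
qed

text \<open>Approximants within \<open>r\<close> of \<open>G\<close> are bounded by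
  \<open>2 * r\<close>, which doubles the constant 4 of the simple case.\<close>

lemma norm_bounded_integral_le:
  assumes "bounded_borel G" "r > 0" "\<And>z. z \<in> S \<Longrightarrow> cmod (G z) \<le> r"
  shows "norm (bounded_integral E S G) \<le> 8 * r * bound"
proof -
  obtain s where s: "\<And>n::nat. simple_function borel\<^sub>S (s n)" "uniform_limit S s G sequentially"
    using assms(1) by (rule bounded_borel_approx) blast
  have "\<forall>\<^sub>F n in sequentially. norm (simple_integral E S (s n)) \<le> 8 * r * bound"
    using uniform_limitD[OF s(2) assms(2)]
  proof eventually_elim
    case (elim n)
    have "cmod (s n z) \<le> 2 * r" if "z \<in> S" for z
      using norm_triangle_sub[of "s n z" "G z"] elim assms(3)[OF that] that
      by (fastforce simp: dist_norm)
    then show ?case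
      using norm_simple_integral_le[OF s(1)[of n], of "2 * r"] assms(2) by simp
  qed
  then show ?thesis
    by (rule tendsto_upperbound[OF tendsto_norm[OF bounded_integral_LIMSEQ[OF s]]]) simp
qed

lemma clinear_bounded_integral:
  assumes "bounded_borel G"
  shows "clinear (blinfun_apply (bounded_integral E S G))"
  unfolding clinear_blinfun_iff
proof (intro allI)
  fix c x
  obtain s where s: "\<And>n::nat. simple_function borel\<^sub>S (s n)" "uniform_limit S s G sequentially"
    using assms(1) by (rule bounded_borel_approx) blast
  have lim: "(\<lambda>n. simple_integral E S (s n) y) \<longlonglongrightarrow> bounded_integral E S G y" for y
    by (intro blinfun.tendsto tendsto_const bounded_integral_LIMSEQ s)
  have "simple_integral E S (s n) (c *\<^sub>C x) = c *\<^sub>C simple_integral E S (s n) x" for n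
    using clinear_simple_integral[OF s(1)] by (simp add: clinear_blinfun_iff)
  then have "(\<lambda>n. c *\<^sub>C simple_integral E S (s n) x) \<longlonglongrightarrow> bounded_integral E S G (c *\<^sub>C x)"
    using lim[of "c *\<^sub>C x"] by simp
  moreover have "(\<lambda>n. c *\<^sub>C simple_integral E S (s n) x) \<longlonglongrightarrow> c *\<^sub>C bounded_integral E S G x"
    by (intro bounded_linear.tendsto[OF bounded_linear_scaleC] lim)
  ultimately show "bounded_integral E S G (c *\<^sub>C x) = c *\<^sub>C bounded_integral E S G x"
    by (rule LIMSEQ_unique)
qed

subsection \<open>The spectrum of a spectral integral\<close>

definition trunc_set :: "(complex \<Rightarrow> complex) \<Rightarrow> nat \<Rightarrow> complex set"
  where "trunc_set F n = {z \<in> S. cmod (F z) \<le> real n}"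

abbreviation "trunc F n \<equiv> \<lambda>z. F z * indicator (trunc_set F n) z"

lemma spectral_integral_iff:
  "(f, g) \<in> spectral_integral E S F \<longleftrightarrow> (\<lambda>n. bounded_integral E S (trunc F n) f) \<longlonglongrightarrow> g"
  by (simp add: spectral_integral_def trunc_set_def)

lemma trunc_set_borel:
  assumes [measurable]: "F \<in> borel_measurable borel\<^sub>S"
  shows "trunc_set F n \<in> sets borel"
proof -
  have "{z \<in> space borel\<^sub>S. cmod (F z) \<le> real n} \<in> sets borel\<^sub>S" by measurable
  then show ?thesis by (simp add: sets_borel_S trunc_set_def)
qed

lemma bounded_borel_trunc:
  assumes F: "F \<in> borel_measurable borel\<^sub>S"
  shows "bounded_borel (trunc F n)"
proof (rule bounded_borelI)
  have "(indicator (trunc_set F n) :: complex \<Rightarrow> complex) \<in> borel_measurable borel\<^sub>S"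
    using bounded_borel_indicator[OF trunc_set_borel[OF F]] by (auto simp: bounded_borel_def)
  with F show "trunc F n \<in> borel_measurable borel\<^sub>S" by measurable
  show "cmod (trunc F n z) \<le> real n" for z
    by (simp add: trunc_set_def indicator_def)
qed

lemma resolvent_set_spectral_integral:
  assumes F [measurable]: "F \<in> borel_measurable borel\<^sub>S"
    and N [measurable]: "N \<in> sets borel" and EN: "E N = 0"
    and l: "l \<notin> closure (F ` (S - N))"
  shows "l \<in> resolvent_set (spectral_integral E S F)"
proof -
  obtain e where e: "e > 0" "\<And>z. z \<in> S - N \<Longrightarrow> e \<le> dist (F z) l"
    using l by (auto simp: closure_approachable not_less)
  \<comment> \<open>Setting \<open>h\<close> to 0 on \<open>N\<close> keeps it bounded on all of
    \<open>S\<close>, since the distance \<open>e\<close> from \<open>l\<close> is available only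
    off \<open>N\<close>.\<close>
  define h where "h z = (if z \<in> N then 0 else 1 / (F z - l))" for z
  define R where "R = bounded_integral E S h"
  let ?D = "\<lambda>n. trunc_set F n - N"
  have h: "bounded_borel h"
  proof (rule bounded_borelI)
    have [measurable]: "Measurable.pred borel\<^sub>S (\<lambda>z. z \<in> N)"
      using N by (intro measurable_restrict_space1) measurable
    show "h \<in> borel_measurable borel\<^sub>S" unfolding h_def by measurable
    show "cmod (h z) \<le> 1 / e" if "z \<in> S" for z
    proof (cases "z \<in> N")
      case False
      with e(2)[of z] that have "e \<le> cmod (F z - l)" by (simp add: dist_norm)
      then show ?thesis
        using e(1) False by (simp add: h_def norm_divide frac_le)
    qed (use e(1) in \<open>simp add: h_def\<close>)
  qed
  have D: "?D n \<in> sets borel" for n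
    using trunc_set_borel[OF F] N by blast
  have clin: "R (c *\<^sub>C x) = c *\<^sub>C R x" for c x
    using clinear_bounded_integral[OF h] by (simp add: clinear_blinfun_iff R_def)
  \<comment> \<open>Off \<open>N\<close> one has \<open>F * h = 1 + l * h\<close>; on
    \<open>N\<close> both sides of the pointwise identity vanish because \<open>h\<close>
    does.\<close>
  have trunc_R: "bounded_integral E S (trunc F n) o\<^sub>L R = E (?D n) + l *\<^sub>C (E (?D n) o\<^sub>L R)" for n
  proof -
    have "bounded_integral E S (trunc F n) o\<^sub>L R = bounded_integral E S (\<lambda>z. trunc F n z * h z)"
      by (simp add: R_def bounded_integral_mult bounded_borel_trunc F h)
    also have "\<dots> = bounded_integral E S (\<lambda>z. indicator (?D n) z + l * (indicator (?D n) z * h z))"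
    proof (rule bounded_integral_cong)
      fix z assume "z \<in> S"
      then have "F z \<noteq> l" if "z \<notin> N" using e that by fastforce
      then show "trunc F n z * h z = indicator (?D n) z + l * (indicator (?D n) z * h z)"
        by (auto simp: h_def indicator_def field_simps)
    qed
    also have "\<dots> = E (?D n) + l *\<^sub>C (E (?D n) o\<^sub>L R)"
      using bounded_borel_indicator[OF D] h
      by (simp add: bounded_integral_add bounded_integral_cmult bounded_borel_mult
          bounded_borel_const bounded_integral_mult bounded_integral_indicator D R_def)
    finally show ?thesis .
  qed
  \<comment> \<open>Pointwise products commute, hence so do the integrals; this yields the left
    inverse from the same limit as the right inverse.\<close>
  have R_trunc: "R o\<^sub>L bounded_integral E S (trunc F n) = bounded_integral E S (trunc F n) o\<^sub>L R" for n
    unfolding R_def bounded_integral_mult[OF h bounded_borel_trunc[OF F], symmetric]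
      bounded_integral_mult[OF bounded_borel_trunc[OF F] h, symmetric]
    by (simp add: mult.commute)
  \<comment> \<open>The sets \<open>?D n\<close> increase to \<open>S - N\<close>, on which
    \<open>E\<close> is the identity.\<close>
  have E_D: "(\<lambda>n. E (?D n) f) \<longlonglongrightarrow> f" for f
  proof -
    have "incseq ?D" by (auto simp: incseq_def trunc_set_def)
    then have "(\<lambda>n. E (?D n) f) \<longlonglongrightarrow> E (\<Union>n. ?D n) f"
      using D by (rule E_incseq_LIMSEQ)
    moreover have "(\<Union>n. ?D n) = S - N"
      by (auto simp: trunc_set_def intro: real_arch_simple)
    ultimately show ?thesis using EN by (simp add: E_Diff_null)
  qed
  have lim: "(\<lambda>n. bounded_integral E S (trunc F n) (R f)) \<longlonglongrightarrow> f + l *\<^sub>C R f" for f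
  proof -
    have "bounded_integral E S (trunc F n) (R f) = E (?D n) f + l *\<^sub>C E (?D n) (R f)" for n
      using arg_cong[OF trunc_R[of n], of "\<lambda>T. blinfun_apply T f"]
      by (simp add: blinfun.add_left scaleC_blinfun.rep_eq)
    then show ?thesis
      by (simp add: tendsto_add E_D bounded_linear.tendsto[OF bounded_linear_scaleC])
  qed
  have "(minus_scalar (spectral_integral E S F) l)\<inverse> = {(g, R g) | g. True}"
  proof (intro equalityI subsetI)
    fix p assume "p \<in> (minus_scalar (spectral_integral E S F) l)\<inverse>"
    then obtain f g where p: "p = (g - l *\<^sub>C f, f)" and fg: "(f, g) \<in> spectral_integral E S F"
      by (auto simp: minus_scalar_def)
    have "(\<lambda>n. R (bounded_integral E S (trunc F n) f)) \<longlonglongrightarrow> R g"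
      using fg by (intro blinfun.tendsto tendsto_const) (simp add: spectral_integral_iff)
    moreover have "R (bounded_integral E S (trunc F n) f) = bounded_integral E S (trunc F n) (R f)" for n
      using arg_cong[OF R_trunc[of n], of "\<lambda>T. blinfun_apply T f"] by simp
    \<comment> \<open>Rearranged, this says that \<open>R\<close> sends
      \<open>g - l *\<^sub>C f\<close> back to \<open>f\<close>.\<close>
    ultimately have "R g = f + l *\<^sub>C R f"
      using lim[of f] LIMSEQ_unique by auto
    then show "p \<in> {(g, R g) | g. True}"
      by (simp add: p blinfun.diff_right clin)
  next
    fix p assume "p \<in> {(g, R g) | g. True}"
    then obtain g where p: "p = (g, R g)" by blast
    have "(R g, g + l *\<^sub>C R g) \<in> spectral_integral E S F"
      using lim by (simp add: spectral_integral_iff)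
    then have "(R g, (g + l *\<^sub>C R g) - l *\<^sub>C R g) \<in> minus_scalar (spectral_integral E S F) l"
      unfolding minus_scalar_def by blast
    then show "p \<in> (minus_scalar (spectral_integral E S F) l)\<inverse>" by (simp add: p)
  qed
  then show ?thesis
    unfolding resolvent_set_def using clin by (auto simp: clinear_blinfun_iff intro!: exI[of _ R])
qed

text \<open>On the range of \<open>E D\<close> the operator minus \<open>l\<close> has norm at most
  \<open>8 * e * bound\<close>. A bounded inverse \<open>R\<close> would recover each vector there
  from its image, which is impossible once \<open>norm R * (8 * e * bound) < 1\<close>.\<close>

lemma spectrum_spectral_integral:
  assumes F [measurable]: "F \<in> borel_measurable borel\<^sub>S"
    and approx: "\<And>e. e > 0 \<Longrightarrow> \<exists>D\<in>sets borel. E D \<noteq> 0 \<and> (\<forall>z\<in>D \<inter> S. cmod (F z - l) \<le> e)"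
  shows "l \<in> spectrum (spectral_integral E S F)"
  unfolding spectrum_def
proof
  assume "l \<in> resolvent_set (spectral_integral E S F)"
  then obtain R :: "'a \<Rightarrow>\<^sub>L 'a" where
    R: "(minus_scalar (spectral_integral E S F) l)\<inverse> = {(g, R g) | g. True}"
    by (auto simp: resolvent_set_def)
  \<comment> \<open>The value solves \<open>norm R * (8 * e * bound) < 1\<close>; the summand 1
    covers the case that \<open>R\<close> or \<open>bound\<close> is 0.\<close>
  define e where "e = 1 / (8 * bound * norm R + 1)"
  have *: "8 * bound * norm R + 1 > 0" using bound_nonneg by (simp add: add_nonneg_pos)
  then have e: "e > 0" "norm R * (8 * e * bound) < 1"
    by (simp_all add: e_def field_simps)
  obtain D where D: "D \<in> sets borel" "E D \<noteq> 0" "\<And>z. z \<in> D \<Longrightarrow> z \<in> S \<Longrightarrow> cmod (F z - l) \<le> e"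
    using approx[OF e(1)] by auto
  obtain f0 where "E D f0 \<noteq> 0" using D(2) by (metis blinfun_eqI zero_blinfun.rep_eq)
  define f where "f = E D f0"
  \<comment> \<open>\<open>E D\<close> is idempotent, by \<open>E_Int\<close> with both sets equal
    to \<open>D\<close>, so it fixes its range.\<close>
  have f: "f \<noteq> 0" "E D f = f"
    using \<open>E D f0 \<noteq> 0\<close> arg_cong[OF E_Int[OF D(1) D(1)], of "\<lambda>T. blinfun_apply T f0"]
    by (simp_all add: f_def)
  have ind: "bounded_borel (indicator D)" by (rule bounded_borel_indicator[OF D(1)])
  define G where "G z = (F z - l) * indicator D z" for z
  have G_le: "cmod (G z) \<le> e" if "z \<in> S" for z
    using D(3) that e(1) by (simp add: G_def indicator_def)
  have G: "bounded_borel G"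
  proof (rule bounded_borelI[OF _ G_le])
    have "(indicator D :: complex \<Rightarrow> complex) \<in> borel_measurable borel\<^sub>S"
      using ind by (auto simp: bounded_borel_def)
    then show "G \<in> borel_measurable borel\<^sub>S" unfolding G_def by measurable
  qed
  \<comment> \<open>On \<open>D\<close> the modulus of \<open>F\<close> is at most
    \<open>cmod l + e\<close>, so larger truncations leave it unchanged there. The defining sequence
    is eventually constant at \<open>f\<close>, which puts \<open>f\<close> in the domain.\<close>
  have "bounded_integral E S (trunc F n) f = bounded_integral E S G f + l *\<^sub>C f"
    if n: "cmod l + e \<le> real n" for n
  proof -
    have "bounded_integral E S (trunc F n) o\<^sub>L E D =
        bounded_integral E S (\<lambda>z. trunc F n z * indicator D z)"
      by (simp add: bounded_integral_mult bounded_borel_trunc F ind bounded_integral_indicator D(1))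
    also have "\<dots> = bounded_integral E S (\<lambda>z. G z + l * indicator D z)"
    proof (rule bounded_integral_cong)
      fix z assume z: "z \<in> S"
      have "cmod (F z) \<le> real n" if "z \<in> D"
        using D(3)[OF that z] n norm_triangle_sub[of "F z" l] by linarith
      then show "trunc F n z * indicator D z = G z + l * indicator D z"
        using z by (auto simp: G_def indicator_def trunc_set_def)
    qed
    also have "\<dots> = bounded_integral E S G + l *\<^sub>C E D"
      by (simp add: bounded_integral_add bounded_integral_cmult bounded_borel_mult
          bounded_borel_const G ind bounded_integral_indicator D(1))
    finally show ?thesis
      using f(2) by (metis blinfun.add_left blinfun_apply_blinfun_compose scaleC_blinfun.rep_eq)
  qed
  moreover obtain n0 :: nat where "cmod l + e \<le> real n0" using real_arch_simple by blast
  ultimately have "\<forall>n\<ge>n0. bounded_integral E S (trunc F n) f = bounded_integral E S G f + l *\<^sub>C f"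
    by (meson of_nat_mono order_trans)
  then have "(\<lambda>n. bounded_integral E S (trunc F n) f) \<longlonglongrightarrow> bounded_integral E S G f + l *\<^sub>C f"
    by (intro tendsto_eventually) (auto simp: eventually_sequentially)
  then have "(f, (bounded_integral E S G f + l *\<^sub>C f) - l *\<^sub>C f) \<in> minus_scalar (spectral_integral E S F) l"
    unfolding minus_scalar_def spectral_integral_iff[symmetric] by blast
  then have "(bounded_integral E S G f, f) \<in> (minus_scalar (spectral_integral E S F) l)\<inverse>"
    by simp
  then have "(bounded_integral E S G f, f) \<in> {(g, R g) | g. True}" unfolding R .
  then have "f = R (bounded_integral E S G f)" by simp
  then have "norm f \<le> norm R * norm (bounded_integral E S G f)" by (metis norm_blinfun)
  also have "\<dots> \<le> norm R * (8 * e * bound * norm f)"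
    using norm_bounded_integral_le[OF G e(1) G_le]
    by (intro mult_left_mono order_trans[OF norm_blinfun] mult_right_mono) auto
  also have "\<dots> < norm f"
    using e(2) f(1) mult_strict_right_mono[of "norm R * (8 * e * bound)" 1 "norm f"]
    by (simp add: mult.assoc)
  finally show False by simp
qed

lemma spectrum_spectral_integral_subset:
  assumes "F \<in> borel_measurable borel\<^sub>S" "N \<in> sets borel" "E N = 0"
  shows "spectrum (spectral_integral E S F) \<subseteq> closure (F ` (S - N))"
  using resolvent_set_spectral_integral[OF assms] by (auto simp: spectrum_def)

end

section \<open>The support of the resolution of the identity\<close>

text \<open>The spectrum of \<open>A\<close> is the complement of the largest open null set of \<open>E\<close>.\<close>

lemma resolution_of_identity_support:
  fixes A :: "'a::complex_banach op_graph"
  assumes "resolution_of_identity A E"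
  shows "closed (spectrum A)" and "E (spectrum A) = id_blinfun"
    and "\<And>U. open U \<Longrightarrow> U \<inter> spectrum A \<noteq> {} \<Longrightarrow> E U \<noteq> 0"
proof -
  have A: "A = spectral_integral E UNIV (\<lambda>z. z)"
    using assms by (simp add: resolution_of_identity_def)
  interpret spectral_meas E
    using assms by unfold_locales (simp add: resolution_of_identity_def)
  interpret U: spectral_meas_on E UNIV
    by unfold_locales simp_all
  obtain B :: "complex set set" where B: "countable B" "topological_basis B"
    using ex_countable_basis by blast
  \<comment> \<open>A countable basis reduces the union of all open null sets to a countable one;
    the empty set is added so that the family can be enumerated even if no basic set is
    null.\<close>
  define \<N> where "\<N> = insert {} {C \<in> B. E C = 0}"
  define V where "V = \<Union>\<N>"
  have open_\<N>: "open C" and null_\<N>: "E C = 0" if "C \<in> \<N>" for C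
    using that topological_basis_open[OF B(2)] by (auto simp: \<N>_def)
  have "countable \<N>" "\<N> \<noteq> {}" using B(1) by (auto simp: \<N>_def)
  then have range: "range (from_nat_into \<N>) = \<N>" by (simp add: range_from_nat_into)
  have "from_nat_into \<N> n \<in> \<N>" for n
    using \<open>\<N> \<noteq> {}\<close> by (rule from_nat_into)
  then have "E (\<Union>n. from_nat_into \<N> n) = 0"
    using open_\<N> null_\<N> by (intro E_UN_null) simp_all
  then have EV: "E V = 0" by (simp add: V_def range)
  have "open V" unfolding V_def using open_\<N> by (intro open_Union) simp
  have null_V: "U \<subseteq> V" if "open U" "E U = 0" for U
  proof
    fix z assume "z \<in> U"
    then obtain C where C: "C \<in> B" "z \<in> C" "C \<subseteq> U"
      using topological_basisE[OF B(2) \<open>open U\<close>] by blast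
    then have "E C = 0"
      using E_null_subset[of C U] topological_basis_open[OF B(2)] that by auto
    then show "z \<in> V" using C by (auto simp: V_def \<N>_def)
  qed
  \<comment> \<open>Both criteria are applied to the identity function on the plane: here with the
    null set \<open>V\<close>, whose complement is already closed, and below with balls around
    points outside \<open>V\<close>, which cannot be null.\<close>
  have "spectrum A \<subseteq> closure ((\<lambda>z. z) ` (UNIV - V))"
    unfolding A using \<open>open V\<close> EV by (intro U.spectrum_spectral_integral_subset) auto
  then have sub: "spectrum A \<subseteq> - V"
    using \<open>open V\<close> by (simp add: Compl_eq_Diff_UNIV[symmetric] closure_closed closed_Compl)
  have sup: "z \<in> spectrum A" if "z \<notin> V" for z
    unfolding A
  proof (rule U.spectrum_spectral_integral)
    fix e :: real assume "e > 0"
    then have "E (ball z e) \<noteq> 0" using null_V[of "ball z e"] that centre_in_ball[of z e] by blast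
    then show "\<exists>D\<in>sets borel. E D \<noteq> 0 \<and> (\<forall>w\<in>D \<inter> UNIV. cmod (w - z) \<le> e)"
      by (intro bexI[of _ "ball z e"]) (auto simp: dist_norm norm_minus_commute)
  qed auto
  have spec: "spectrum A = UNIV - V" using sub sup by auto
  show "closed (spectrum A)" using \<open>open V\<close> by (simp add: spec Compl_eq_Diff_UNIV[symmetric] closed_Compl)
  show "E (spectrum A) = id_blinfun" using \<open>open V\<close> EV by (simp add: spec E_Diff_null)
  show "E U \<noteq> 0" if "open U" "U \<inter> spectrum A \<noteq> {}" for U
    using null_V[of U] that by (auto simp: spec)
qed

theorem theorem3p1:
  fixes A :: "'a::complex_banach op_graph"
    and E :: "complex set \<Rightarrow> 'a \<Rightarrow>\<^sub>L 'a"
  assumes "scalar_type_spectral A"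
    and "resolution_of_identity A E"
  shows "(\<forall>F \<in> borel_measurable (restrict_space borel (spectrum A)).
            \<forall>N \<in> sets borel. N \<subseteq> spectrum A \<longrightarrow> E N = 0 \<longrightarrow>
              spectrum (borel_calculus A E F) \<subseteq> closure (F ` (spectrum A - N))) \<and>
         (\<forall>F \<in> borel_measurable (restrict_space borel (spectrum A)).
            \<forall>N \<in> sets borel. N \<subseteq> spectrum A \<longrightarrow> E N = 0 \<longrightarrow>
              continuous_on (spectrum A - N) F \<longrightarrow>
              spectrum (borel_calculus A E F) = closure (F ` (spectrum A - N)))"
proof -
  note support = resolution_of_identity_support[OF assms(2)]
  \<comment> \<open>Closedness makes the spectrum Borel and \<open>E (spectrum A)\<close> is the
    identity, so the spectrum itself is an admissible carrier.\<close>
  interpret spectral_meas_on E "spectrum A"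
    using assms(2) support(1,2) by unfold_locales (simp_all add: resolution_of_identity_def)
  have sub: "spectrum (borel_calculus A E F) \<subseteq> closure (F ` (spectrum A - N))"
    if "F \<in> borel_measurable borel\<^sub>S" "N \<in> sets borel" "E N = 0" for F N
    using spectrum_spectral_integral_subset[OF that] by (simp add: borel_calculus_def)
  have "closure (F ` (spectrum A - N)) \<subseteq> spectrum (borel_calculus A E F)"
    if F: "F \<in> borel_measurable borel\<^sub>S" and N: "N \<in> sets borel" "E N = 0"
      and cont: "continuous_on (spectrum A - N) F" for F N
  proof
    fix l assume l: "l \<in> closure (F ` (spectrum A - N))"
    show "l \<in> spectrum (borel_calculus A E F)"
      unfolding borel_calculus_def
    proof (rule spectrum_spectral_integral[OF F])
      fix e :: real assume "e > 0"
      \<comment> \<open>One half of \<open>e\<close> is spent on the distance from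
        \<open>F z0\<close> to \<open>l\<close>, the other on the oscillation of \<open>F\<close>
        near \<open>z0\<close>.\<close>
      then obtain z0 where z0: "z0 \<in> spectrum A - N" "dist (F z0) l < e / 2"
        using l half_gt_zero[OF \<open>e > 0\<close>] unfolding closure_approachable by blast
      obtain d where d: "d > 0" "\<And>z. z \<in> spectrum A - N \<Longrightarrow> dist z z0 < d \<Longrightarrow> dist (F z) (F z0) < e / 2"
        using cont z0(1) half_gt_zero[OF \<open>e > 0\<close>] unfolding continuous_on_iff by metis
      have "E (ball z0 d) \<noteq> 0"
        using z0(1) d(1) by (intro support(3)) (auto intro!: centre_in_ball[THEN iffD2])
      \<comment> \<open>Continuity controls \<open>F\<close> only off \<open>N\<close>; removing
        this null set does not change the projection of the ball, which is nonzero because the ball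
        meets the spectrum at \<open>z0\<close>.\<close>
      then have "E (ball z0 d - N) \<noteq> 0" using N by (simp add: E_Diff_null)
      moreover have "cmod (F z - l) \<le> e" if "z \<in> (ball z0 d - N) \<inter> spectrum A" for z
        using dist_triangle[of "F z" l "F z0"] d(2)[of z] z0(2) that
        by (auto simp: dist_norm norm_minus_commute)
      ultimately show "\<exists>D\<in>sets borel. E D \<noteq> 0 \<and> (\<forall>z\<in>D \<inter> spectrum A. cmod (F z - l) \<le> e)"
        using N(1) by (intro bexI[of _ "ball z0 d - N"]) auto
    qed
  qed
  with sub show ?thesis by blast
qed

end
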